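(* For every positive integer $n$, \[ \psi_{+}(n)=\begin{cases} 1&\text{when }n=1,2,\\ 2&\text{when }n=3,\\ 3&\text{when }n=4,\text{ or when $n$ is odd and }n>3,\\ 5&\text{when $n$ is even and }n>4. \end{cases} \]
   Context: A partial latin square (PLS) is a matrix in which some cells may be empty and in which any two filled cells in the same row or column contain distinct symbols; moreover each row and each column of a PLS is required to contain at least one filled cell. The size of a PLS is its number of filled cells. A PLS $P$ embeds in a group $G$ if there are injective maps $I_1$, $I_2$, $I_3$ from, respectively, the rows, the columns and the symbols of $P$ to $G$ such that $I_1(r)I_2(c)=I_3(s)$ whenever symbol $s$ occurs in cell $(r,c)$ of $P$. $\psi_{+}(n)$ denotes the largest number $m$ such that for every PLS $P$ of size $m$ there is some abelian group of order $n$ in which $P$ can be embedded. *)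

theory Defs
  imports "HOL-Algebra.Algebra"
begin

text \<open>Only the entries in rows \<open>i < nrows P\<close> and columns \<open>j < ncols P\<close> are part of the matrix;
  \<open>None\<close> is an empty cell.\<close>

record 's partial_matrix =
  nrows :: nat
  ncols :: nat
  entry :: "nat \<Rightarrow> nat \<Rightarrow> 's option"

definition filled_cells :: "'s partial_matrix \<Rightarrow> (nat \<times> nat) set" where
  "filled_cells P = {(i, j). i < nrows P \<and> j < ncols P \<and> entry P i j \<noteq> None}"

definition symbols :: "'s partial_matrix \<Rightarrow> 's set" where
  "symbols P = {s. \<exists>i < nrows P. \<exists>j < ncols P. entry P i j = Some s}"

definition is_PLS :: "'s partial_matrix \<Rightarrow> bool" where
  "is_PLS P \<longleftrightarrow>
     (\<forall>i j j'. (i, j) \<in> filled_cells P \<and> (i, j') \<in> filled_cells P \<and> j \<noteq> j'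
        \<longrightarrow> entry P i j \<noteq> entry P i j') \<and>
     (\<forall>i i' j. (i, j) \<in> filled_cells P \<and> (i', j) \<in> filled_cells P \<and> i \<noteq> i'
        \<longrightarrow> entry P i j \<noteq> entry P i' j) \<and>
     (\<forall>i < nrows P. \<exists>j. (i, j) \<in> filled_cells P) \<and>
     (\<forall>j < ncols P. \<exists>i. (i, j) \<in> filled_cells P)"

definition PLS_size :: "'s partial_matrix \<Rightarrow> nat" where
  "PLS_size P = card (filled_cells P)"

definition embeds_in :: "'s partial_matrix \<Rightarrow> ('g, 'm) monoid_scheme \<Rightarrow> bool" where
  "embeds_in P G \<longleftrightarrow>
     (\<exists>I1 I2 I3.
        I1 \<in> {..<nrows P} \<rightarrow> carrier G \<and> inj_on I1 {..<nrows P} \<and>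
        I2 \<in> {..<ncols P} \<rightarrow> carrier G \<and> inj_on I2 {..<ncols P} \<and>
        I3 \<in> symbols P \<rightarrow> carrier G \<and> inj_on I3 (symbols P) \<and>
        (\<forall>r < nrows P. \<forall>c < ncols P. \<forall>s. entry P r c = Some s
           \<longrightarrow> I1 r \<otimes>\<^bsub>G\<^esub> I2 c = I3 s))"

text \<open>Symbols are taken from \<^typ>\<open>nat\<close> and groups have their carrier in \<^typ>\<open>int\<close>. As a partial
  latin square has only finitely many symbols and, for \<open>n > 0\<close>, a group of order \<open>n\<close> is
  finite, every isomorphism class is represented; for groups see \<open>embeds_in_int_group\<close> below.
  The number \<open>GREATEST m. \<dots>\<close> is meaningful for \<open>n > 0\<close>: a single column of \<open>m > n\<close> distinct
  symbols embeds in no group of order \<open>n\<close>, so the eligible \<open>m\<close> are bounded.\<close>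

definition psi_plus :: "nat \<Rightarrow> nat" where
  "psi_plus n = (GREATEST m. \<forall>P :: nat partial_matrix. is_PLS P \<and> PLS_size P = m \<longrightarrow>
     (\<exists>G :: int monoid. comm_group G \<and> order G = n \<and> embeds_in P G))"

lemma embeds_in_iso:
  assumes h: "h \<in> iso G H" and P: "embeds_in P G"
  shows "embeds_in P H"
proof -
  from P obtain I1 I2 I3 where I:
    "I1 \<in> {..<nrows P} \<rightarrow> carrier G" "inj_on I1 {..<nrows P}"
    "I2 \<in> {..<ncols P} \<rightarrow> carrier G" "inj_on I2 {..<ncols P}"
    "I3 \<in> symbols P \<rightarrow> carrier G" "inj_on I3 (symbols P)"
    "\<forall>r < nrows P. \<forall>c < ncols P. \<forall>s. entry P r c = Some s \<longrightarrow> I1 r \<otimes>\<^bsub>G\<^esub> I2 c = I3 s"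
    unfolding embeds_in_def by blast
  have hh: "h \<in> hom G H" and inj: "inj_on h (carrier G)"
    using h by (auto simp: iso_def bij_betw_def)
  have "(h \<circ> I1) r \<otimes>\<^bsub>H\<^esub> (h \<circ> I2) c = (h \<circ> I3) s"
    if "r < nrows P" "c < ncols P" "entry P r c = Some s" for r c s
  proof -
    have "I1 r \<in> carrier G" "I2 c \<in> carrier G" using I that by auto
    then show ?thesis using hom_mult[OF hh] I(7) that by (metis comp_apply)
  qed
  moreover have "inj_on (h \<circ> I1) {..<nrows P}" "inj_on (h \<circ> I2) {..<ncols P}"
      "inj_on (h \<circ> I3) (symbols P)"
    using I by (auto intro!: comp_inj_on inj_on_subset[OF inj])
  moreover have "h \<circ> I1 \<in> {..<nrows P} \<rightarrow> carrier H" "h \<circ> I2 \<in> {..<ncols P} \<rightarrow> carrier H"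
      "h \<circ> I3 \<in> symbols P \<rightarrow> carrier H"
    using I hom_in_carrier[OF hh] by (auto dest!: funcset_mem)
  ultimately show ?thesis unfolding embeds_in_def by blast
qed

lemma embeds_in_int_group:
  fixes G :: "('g, 'm) monoid_scheme"
  assumes G: "comm_group G" "order G = n" "n > 0" and P: "embeds_in P G"
  shows "\<exists>H :: int monoid. comm_group H \<and> order H = n \<and> embeds_in P H"
proof -
  interpret G: comm_group G by fact
  have "finite (carrier G)" using G by (auto simp: order_def intro: card_ge_0_finite)
  then obtain f :: "'g \<Rightarrow> nat" where "inj_on f (carrier G)"
    by (metis finite_imp_inj_to_nat_seg)
  define h where "h = int \<circ> f"
  have inj: "inj_on h (carrier G)"
    unfolding h_def using \<open>inj_on f (carrier G)\<close> by (simp add: comp_inj_on)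
  define k where "k = inv_into (carrier G) h"
  define H :: "int monoid" where
    "H = \<lparr>carrier = h ` carrier G, monoid.mult = (\<lambda>x y. h (k x \<otimes>\<^bsub>G\<^esub> k y)), one = h \<one>\<^bsub>G\<^esub>\<rparr>"
  have k: "k (h x) = x" if "x \<in> carrier G" for x
    using that inj by (simp add: k_def)
  have iso: "h \<in> iso G H"
    using inj by (auto simp: iso_def hom_def bij_betw_def H_def k)
  have "comm_group H"
  proof (rule comm_groupI)
    fix x assume "x \<in> carrier H"
    then obtain a where "a \<in> carrier G" "x = h a" by (auto simp: H_def)
    then show "\<exists>y\<in>carrier H. y \<otimes>\<^bsub>H\<^esub> x = \<one>\<^bsub>H\<^esub>"
      by (intro bexI[of _ "h (inv\<^bsub>G\<^esub> a)"]) (auto simp: H_def k)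
  qed (auto simp: H_def k G.m_ac)
  moreover have "order H = n"
    using G inj by (simp add: order_def H_def card_image)
  ultimately show ?thesis using embeds_in_iso[OF iso P] by blast
qed

end

theory Submission imports Defs begin

text \<open>
  A partial latin square of size \<open>m\<close> is a set of \<open>m\<close> cells, each with a row, a column and a symbol,
  such that two different cells share at most one of the three. Embedding it in a cyclic group of
  order \<open>n\<close> means choosing, for every cell, integers \<open>x\<close>, \<open>y\<close>, \<open>z\<close> with sum \<open>0\<close> modulo \<open>n\<close> that
  distinguish modulo \<open>n\<close> exactly the rows, the columns and the symbols; \<open>z\<close> is the negative of the
  image of the symbol, so that the three coordinates play symmetric roles
  (\<open>embeds_in_cyclic_group\<close>).

  Lower bounds. If \<open>2 \<le> m \<le> 5\<close> and the square contains no intercalate (a latin subsquare of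
  order 2), then there are such labels in the integers, with sum exactly \<open>0\<close>, and any two values of
  \<open>x\<close>, of \<open>y\<close> or of \<open>z\<close> differ by at most \<open>m\<close>. Different labels therefore stay
  different modulo every \<open>n > m\<close>, and one labelling serves all these \<open>n\<close> at once
  (\<open>realizable_of_no_intercalate\<close>). The existence of the labels depends only on the three partitions
  of the cells into rows, columns and symbols, so it is a finite problem, settled by a search.
  An intercalate has four cells, so this covers the sizes 2 and 3 for all
  \<open>n > m\<close>. For size 5 an intercalate may occur; its row, column and symbol differences have order two, which is possible when \<open>n = 2 h\<close> by
  using the labels \<open>0\<close> and \<open>h\<close>. The fifth cell shares at most one of its row, column and symbol
  with the intercalate, which leaves enough freedom as soon as \<open>h \<ge> 3\<close> (\<open>intercalate_plus_one\<close>).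

  Upper bounds. A square that does not embed stays so when a cell in a new row and a new column
  is added, so one obstruction just above the claimed value suffices (\<open>psi_plus_eqI\<close>).
  There are three of them. If \<open>f\<close> and \<open>g\<close> both enumerate a group of order \<open>k\<close> and
  \<open>k - 1\<close> of the products \<open>f i g i\<close> are equal, then so are all \<open>k\<close>; hence a \<open>k\<close> by \<open>k\<close>
  diagonal with all but one symbol equal does not embed. An intercalate needs an element of order
  two, hence an even order. Finally, in an abelian group \<open>x\<^sub>0 y\<^sub>1 = x\<^sub>1 y\<^sub>0\<close> and
  \<open>x\<^sub>0 y\<^sub>2 = x\<^sub>2 y\<^sub>0\<close> imply \<open>x\<^sub>1 y\<^sub>2 = x\<^sub>2 y\<^sub>1\<close> (the Thomsen condition), and six cells suffice to
  violate this.
\<close>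

section \<open>Partial latin squares as sets of labelled cells\<close>

text \<open>The cells form an abstract set \<open>A\<close> and the coordinates are functions \<open>R\<close>, \<open>C\<close>, \<open>S\<close> on it; this
  makes the symmetry between rows, columns and symbols a mere permutation of arguments.\<close>

definition latin :: "'a set \<Rightarrow> ('a \<Rightarrow> 'b) \<Rightarrow> ('a \<Rightarrow> 'c) \<Rightarrow> ('a \<Rightarrow> 'd) \<Rightarrow> bool" where
  "latin A R C S \<longleftrightarrow> inj_on (\<lambda>i. (R i, C i)) A \<and> inj_on (\<lambda>i. (R i, S i)) A \<and> inj_on (\<lambda>i. (C i, S i)) A"

lemma latin_swap12: "latin A R C S \<Longrightarrow> latin A C R S" and latin_swap13: "latin A R C S \<Longrightarrow> latin A S C R"
  by (auto simp: latin_def inj_on_def)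

text \<open>The cells \<open>a b\<close> over \<open>c d\<close> carry the symbols \<open>s t\<close> over \<open>t s\<close>. The pairings \<open>ab|cd\<close>, \<open>ac|bd\<close>,
  \<open>ad|bc\<close> of the four cells given by rows, columns and symbols are the three perfect matchings, whence the
  symmetry lemmas below.\<close>

definition intercalate :: "'a set \<Rightarrow> ('a \<Rightarrow> 'b) \<Rightarrow> ('a \<Rightarrow> 'c) \<Rightarrow> ('a \<Rightarrow> 'd) \<Rightarrow> bool" where
  "intercalate A R C S \<longleftrightarrow> (\<exists>a\<in>A. \<exists>b\<in>A. \<exists>c\<in>A. \<exists>d\<in>A.
     R a = R b \<and> R c = R d \<and> R a \<noteq> R c \<and>
     C a = C c \<and> C b = C d \<and> C a \<noteq> C b \<and>
     S a = S d \<and> S b = S c \<and> S a \<noteq> S b)"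

lemma intercalate_swap12: "intercalate A R C S \<Longrightarrow> intercalate A C R S"
  unfolding intercalate_def by metis

lemma intercalate_swap13: "intercalate A R C S \<Longrightarrow> intercalate A S C R"
  unfolding intercalate_def by metis

text \<open>The four cells are pairwise different since they differ in their rows or in their columns.\<close>

lemma intercalate_card:
  assumes "finite A" "intercalate A R C S"
  shows "4 \<le> card A"
proof -
  obtain a b c d where "{a, b, c, d} \<subseteq> A" and "R a = R b" "R c = R d" "R a \<noteq> R c"
     "C a = C c" "C b = C d" "C a \<noteq> C b"
    using assms(2) unfolding intercalate_def by auto
  then have "card {a, b, c, d} = 4" "card {a, b, c, d} \<le> card A"
    using card_mono[OF assms(1), of "{a, b, c, d}"] by (auto simp: card_insert_if)
  then show ?thesis by simp
qed

section \<open>From integer labels to an embedding in a cyclic group\<close>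

text \<open>Modulo \<open>n\<close>, the labels \<open>x\<close> induce an injective map on the values of \<open>R\<close>
  (see \<open>represents_mod_factor\<close>).\<close>

definition represents_mod :: "int \<Rightarrow> 'a set \<Rightarrow> ('a \<Rightarrow> 'b) \<Rightarrow> ('a \<Rightarrow> int) \<Rightarrow> bool" where
  "represents_mod n A R x \<longleftrightarrow> (\<forall>i\<in>A. \<forall>j\<in>A. x i mod n = x j mod n \<longleftrightarrow> R i = R j)"

abbreviation symbol_at :: "'s partial_matrix \<Rightarrow> nat \<times> nat \<Rightarrow> 's" where
  "symbol_at P \<equiv> \<lambda>(i, j). the (entry P i j)"

lemma symbolsI: "i < nrows P \<Longrightarrow> j < ncols P \<Longrightarrow> entry P i j = Some u \<Longrightarrow> u \<in> symbols P"
  by (auto simp: symbols_def)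

lemma finite_filled_cells: "finite (filled_cells P)"
  by (rule finite_subset[of _ "{..<nrows P} \<times> {..<ncols P}"]) (auto simp: filled_cells_def)

lemma PLS_latin:
  assumes "is_PLS P"
  shows "latin (filled_cells P) fst snd (symbol_at P)"
proof -
  have row: "j = j'" if "(i, j) \<in> filled_cells P" "(i, j') \<in> filled_cells P" "the (entry P i j) = the (entry P i j')" for i j j'
  proof -
    have "entry P i j = entry P i j'" using that by (auto simp: filled_cells_def)
    then show ?thesis using assms that unfolding is_PLS_def by blast
  qed
  have col: "i = i'" if "(i, j) \<in> filled_cells P" "(i', j) \<in> filled_cells P" "the (entry P i j) = the (entry P i' j)" for i i' j
  proof -
    have "entry P i j = entry P i' j" using that by (auto simp: filled_cells_def)
    then show ?thesis using assms that unfolding is_PLS_def by blast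
  qed
  show ?thesis
    unfolding latin_def inj_on_def using row col by auto
qed

lemma represents_mod_factor:
  assumes "represents_mod n A R x" "n > 0" and surj: "R ` A = B"
  obtains f where "f \<in> B \<rightarrow> {0..<n}" "inj_on f B" "\<And>i. i \<in> A \<Longrightarrow> f (R i) = x i mod n"
proof -
  define f where "f b = x (inv_into A R b) mod n" for b
  have f: "f (R i) = x i mod n" if "i \<in> A" for i
  proof -
    have "inv_into A R (R i) \<in> A" "R (inv_into A R (R i)) = R i"
      using that by (auto intro: inv_into_into f_inv_into_f)
    then show ?thesis
      using assms(1) that unfolding represents_mod_def f_def by blast
  qed
  show thesis
  proof (rule that)
    show "f \<in> B \<rightarrow> {0..<n}" using \<open>n > 0\<close> by (auto simp: f_def)
    show "inj_on f B"
      using assms(1) f unfolding represents_mod_def surj[symmetric] inj_on_def by auto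
  qed (fact f)
qed

text \<open>Every row, column and symbol of a partial latin square occurs in some filled cell, so labels on
  the cells determine the three maps of an embedding. The symbol map is the negative of \<open>z\<close>.\<close>

lemma embeds_in_cyclic_group:
  assumes P: "is_PLS P" and n: "n > 0" and A: "A = filled_cells P"
    and x: "represents_mod (int n) A fst x" and y: "represents_mod (int n) A snd y"
    and z: "represents_mod (int n) A (symbol_at P) z"
    and sum: "\<And>i. i \<in> A \<Longrightarrow> (x i + y i + z i) mod int n = 0"
  shows "embeds_in P (integer_mod_group n)"
proof -
  have n': "int n > 0" using n by simp
  have img: "fst ` A = {..<nrows P}" "snd ` A = {..<ncols P}"
    using P by (force simp: A is_PLS_def filled_cells_def image_iff)+
  have sym: "symbol_at P ` A = symbols P"
    by (force simp: A filled_cells_def symbols_def image_iff)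
  have neg: "represents_mod (int n) A (symbol_at P) (\<lambda>i. - z i)"
    using z by (simp add: represents_mod_def mod_eq_dvd_iff dvd_diff_commute)
  obtain f where f: "f \<in> {..<nrows P} \<rightarrow> {0..<int n}" "inj_on f {..<nrows P}"
      "\<And>i. i \<in> A \<Longrightarrow> f (fst i) = x i mod int n"
    using represents_mod_factor[OF x n' img(1)] by blast
  obtain g where g: "g \<in> {..<ncols P} \<rightarrow> {0..<int n}" "inj_on g {..<ncols P}"
      "\<And>i. i \<in> A \<Longrightarrow> g (snd i) = y i mod int n"
    using represents_mod_factor[OF y n' img(2)] by blast
  obtain h where h: "h \<in> symbols P \<rightarrow> {0..<int n}" "inj_on h (symbols P)"
      "\<And>i. i \<in> A \<Longrightarrow> h (symbol_at P i) = (- z i) mod int n"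
    using represents_mod_factor[OF neg n' sym] by blast
  have "(f r + g c) mod int n = h s" if "r < nrows P" "c < ncols P" "entry P r c = Some s" for r c s
  proof -
    have cell: "(r, c) \<in> A" using that by (auto simp: A filled_cells_def)
    have "(x (r, c) + y (r, c)) mod int n = (- z (r, c)) mod int n"
      using sum[OF cell] by (simp add: mod_eq_dvd_iff mod_eq_0_iff_dvd)
    then show ?thesis
      using f(3)[OF cell] g(3)[OF cell] h(3)[OF cell] that by (simp add: mod_add_eq)
  qed
  moreover have "carrier (integer_mod_group n) = {0..<int n}"
    using n by (simp add: carrier_integer_mod_group)
  ultimately show ?thesis
    using f(1,2) g(1,2) h(1,2) unfolding embeds_in_def mult_integer_mod_group by metis
qed

section \<open>Integer labels with small spread\<close>

text \<open>Labels that represent \<open>R\<close> in the integers and whose values span an interval of length at most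
  \<open>w\<close>; the second condition makes them represent \<open>R\<close> modulo every \<open>n > w\<close>.\<close>

definition tight :: "int \<Rightarrow> 'a set \<Rightarrow> ('a \<Rightarrow> 'b) \<Rightarrow> ('a \<Rightarrow> int) \<Rightarrow> bool" where
  "tight w A R x \<longleftrightarrow> (\<forall>i\<in>A. \<forall>j\<in>A. (x i = x j \<longleftrightarrow> R i = R j) \<and> x i \<le> x j + w)"

lemma tight_imp_represents_mod:
  assumes "tight w A R x" "w < n"
  shows "represents_mod n A R x"
proof -
  have "x i mod n = x j mod n \<longleftrightarrow> x i = x j" if "i \<in> A" "j \<in> A" for i j
  proof
    have "x i \<le> x j + w" "x j \<le> x i + w"
      using assms(1) that by (simp_all add: tight_def)
    then have near: "\<bar>x i - x j\<bar> < n" using assms(2) by linarith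
    assume "x i mod n = x j mod n"
    then have "n dvd x i - x j" by (simp add: mod_eq_dvd_iff)
    then show "x i = x j" using near zdvd_not_zless[of "\<bar>x i - x j\<bar>" n] by auto
  qed simp
  then show ?thesis
    using assms(1) by (simp add: represents_mod_def tight_def)
qed

definition realizable :: "int \<Rightarrow> 'a set \<Rightarrow> ('a \<Rightarrow> 'b) \<Rightarrow> ('a \<Rightarrow> 'c) \<Rightarrow> ('a \<Rightarrow> 'd) \<Rightarrow> bool" where
  "realizable w A R C S \<longleftrightarrow>
     (\<exists>x y z. tight w A R x \<and> tight w A C y \<and> tight w A S z \<and> (\<forall>i\<in>A. x i + y i + z i = 0))"

lemma realizable_swap12: "realizable w A R C S \<Longrightarrow> realizable w A C R S"
  unfolding realizable_def by (metis add.commute)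

lemma realizable_swap13: "realizable w A R C S \<Longrightarrow> realizable w A S C R"
  unfolding realizable_def by (metis add.commute add.left_commute)

section \<open>Partitions as lists\<close>

text \<open>Lists of equal length are compared by the partitions of their positions into sets of equal
  entries. Only these partitions of the row, column and symbol lists of a square matter for finding labels.\<close>

definition same_kernel :: "'a list \<Rightarrow> 'b list \<Rightarrow> bool" where
  "same_kernel xs ys \<longleftrightarrow> length xs = length ys \<and>
     list_all (\<lambda>(x, y). list_all (\<lambda>(x', y'). (x = x') = (y = y')) (zip xs ys)) (zip xs ys)"

lemma same_kernel_iff_nth:
  "same_kernel xs ys \<longleftrightarrow> length xs = length ys \<and>
     (\<forall>i<length xs. \<forall>j<length xs. (xs ! i = xs ! j) = (ys ! i = ys ! j))"
  by (auto simp: same_kernel_def list_all_length)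

lemma same_kernel_trans: "same_kernel xs ys \<Longrightarrow> same_kernel ys zs \<Longrightarrow> same_kernel xs zs"
  by (simp add: same_kernel_iff_nth)

text \<open>Corresponding entries define a bijection between the two sets of values.\<close>

lemma same_kernel_card:
  assumes "same_kernel xs ys"
  shows "card (set xs) = card (set ys)"
proof -
  let ?A = "{..<length xs}"
  have len: "length ys = length xs"
    using assms by (simp add: same_kernel_iff_nth)
  have ker: "xs ! i = xs ! j \<longleftrightarrow> ys ! i = ys ! j" if "i \<in> ?A" "j \<in> ?A" for i j
    using assms that by (simp add: same_kernel_iff_nth)
  define h where "h v = ys ! (SOME i. i \<in> ?A \<and> xs ! i = v)" for v
  have h: "h (xs ! i) = ys ! i" if "i \<in> ?A" for i
  proof -
    have "(SOME j. j \<in> ?A \<and> xs ! j = xs ! i) \<in> ?A \<and> xs ! (SOME j. j \<in> ?A \<and> xs ! j = xs ! i) = xs ! i"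
      by (rule someI_ex) (use that in auto)
    then show ?thesis using ker that unfolding h_def by blast
  qed
  have "set xs = (!) xs ` ?A" "set ys = (!) ys ` ?A"
    using len by (auto simp: set_conv_nth)
  moreover have "inj_on h ((!) xs ` ?A)" "h ` (!) xs ` ?A = (!) ys ` ?A"
    using h ker by (auto simp: inj_on_def image_image)
  ultimately show ?thesis by (metis card_image)
qed

text \<open>Each partition of \<open>m\<close> positions is represented once: the next position either repeats an entry of
  \<open>p\<close> or opens a new block, whose entry is the position itself.\<close>

fun patterns :: "nat \<Rightarrow> nat list list" where
  "patterns 0 = [[]]"
| "patterns (Suc m) = concat (map (\<lambda>p. map (\<lambda>v. p @ [v]) (m # remdups p)) (patterns m))"

lemma patterns_bounded: "p \<in> set (patterns m) \<Longrightarrow> v \<in> set p \<Longrightarrow> v < m"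
proof (induction m arbitrary: p v)
  case (Suc m)
  then obtain q u where "q \<in> set (patterns m)" "u = m \<or> u \<in> set q" "p = q @ [u]"
    by auto
  moreover from this have "v = u \<or> v \<in> set q" using Suc.prems(2) by auto
  ultimately show ?case using Suc.IH less_SucI by blast
qed simp

lemma patterns_complete: "\<exists>p \<in> set (patterns (length xs)). same_kernel xs p"
proof (induction xs rule: rev_induct)
  case Nil
  then show ?case by (simp add: same_kernel_iff_nth)
next
  case (snoc a xs)
  then obtain p where p: "p \<in> set (patterns (length xs))" "same_kernel xs p" by blast
  have len: "length p = length xs"
    and ker: "\<And>i j. i < length xs \<Longrightarrow> j < length xs \<Longrightarrow> xs ! i = xs ! j \<longleftrightarrow> p ! i = p ! j"
    using p(2) by (auto simp: same_kernel_iff_nth)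
  obtain v where v: "v = length xs \<or> v \<in> set p"
    and va: "\<And>i. i < length xs \<Longrightarrow> xs ! i = a \<longleftrightarrow> p ! i = v"
  proof (cases "a \<in> set xs")
    case True
    then obtain k where "k < length xs" "xs ! k = a" by (auto simp: in_set_conv_nth)
    then show ?thesis using ker len by (intro that[of "p ! k"]) auto
  next
    case False
    have "p ! i \<noteq> length xs" if "i < length xs" for i
      using patterns_bounded[OF p(1), of "p ! i"] that len by auto
    then show ?thesis using False by (intro that[of "length xs"]) auto
  qed
  have "same_kernel (xs @ [a]) (p @ [v])"
    using ker va len unfolding same_kernel_iff_nth
    by (auto simp: nth_append less_Suc_eq)
  moreover have "p @ [v] \<in> set (patterns (length (xs @ [a])))"
    using p(1) v by auto
  ultimately show ?case by blast
qed

text \<open>Lists the positions block by block, larger blocks first. Up to the names of the blocks, the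
  reordered list depends only on the block sizes, so that few row partitions remain to be
  treated.\<close>

definition reorder :: "nat list \<Rightarrow> nat list" where
  "reorder p = (let m = length p in
     sort_key (\<lambda>i. (m - count_list p (p ! i)) * m + p ! i) [0..<m])"

lemma set_reorder: "set (reorder p) = {..<length p}" and distinct_reorder: "distinct (reorder p)"
  by (auto simp: reorder_def Let_def)

section \<open>The search for column labels\<close>

text \<open>Two cells, given as row label \<open>x\<close>, column label \<open>y\<close>, column \<open>c\<close> and symbol \<open>s\<close>, do not contradict each other; the
  symbol label is \<open>x + y\<close> up to sign.\<close>

definition consistent :: "int \<Rightarrow> int \<times> int \<times> nat \<times> nat \<Rightarrow> int \<times> int \<times> nat \<times> nat \<Rightarrow> bool" where
  "consistent w = (\<lambda>(x, y, c, s) (x', y', c', s').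
     (c = c') = (y = y') \<and> (s = s') = (x + y = x' + y') \<and>
        x + y \<le> x' + y' + w \<and> x' + y' \<le> x + y + w)"

text \<open>Backtracking over the column labels of the remaining cells, whose row labels are prescribed. The
  accumulator contains the cells treated so far.\<close>

fun completable :: "int \<Rightarrow> (int \<times> int \<times> nat \<times> nat) list \<Rightarrow> (int \<times> nat \<times> nat) list \<Rightarrow> bool" where
  "completable w acc [] = True"
| "completable w acc ((x, c, s) # ts) =
     list_ex (\<lambda>y. list_all (consistent w (x, y, c, s)) acc \<and> completable w ((x, y, c, s) # acc) ts) [0..w]"

lemma completable_sound:
  assumes "completable w acc ts"
  shows "\<exists>ys. length ys = length ts \<and> set ys \<subseteq> {0..w} \<and>
    (\<forall>i<length ts. \<forall>a\<in>set acc. consistent w (fst (ts ! i), ys ! i, snd (ts ! i)) a) \<and>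
    (\<forall>i<length ts. \<forall>j<i. consistent w (fst (ts ! i), ys ! i, snd (ts ! i)) (fst (ts ! j), ys ! j, snd (ts ! j)))"
  using assms
proof (induction w acc ts rule: completable.induct)
  case (2 w acc x c s ts)
  then obtain y where y: "y \<in> {0..w}" "list_all (consistent w (x, y, c, s)) acc"
      "completable w ((x, y, c, s) # acc) ts"
    by (auto simp: list_ex_iff)
  from "2.IH"[of y, OF _ y(3)] y(1) obtain ys where ys: "length ys = length ts" "set ys \<subseteq> {0..w}"
    "\<forall>i<length ts. \<forall>a\<in>set ((x, y, c, s) # acc). consistent w (fst (ts ! i), ys ! i, snd (ts ! i)) a"
    "\<forall>i<length ts. \<forall>j<i. consistent w (fst (ts ! i), ys ! i, snd (ts ! i)) (fst (ts ! j), ys ! j, snd (ts ! j))"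
    by auto
  show ?case
    using ys y by (intro exI[of _ "y # ys"]) (auto simp: less_Suc_eq_0_disj list_all_iff)
qed auto

lemma tight_nth:
  assumes "length xs = length es" "distinct es"
    and "\<And>i j. i < length es \<Longrightarrow> j < length es \<Longrightarrow> (xs ! i = xs ! j \<longleftrightarrow> R (es ! i) = R (es ! j)) \<and> xs ! i \<le> xs ! j + w"
  shows "tight w (set es) R (\<lambda>a. the (map_of (zip es xs) a))"
proof -
  have "the (map_of (zip es xs) (es ! i)) = xs ! i" if "i < length es" for i
    using assms(1,2) that by (simp add: map_of_zip_nth)
  then show ?thesis
    using assms(3) by (auto simp: tight_def in_set_conv_nth)
qed

lemma realizable_if_completable:
  assumes sol: "completable w [] (zip xs (zip cs ss))" and es: "distinct es"
    and R: "same_kernel (map R es) xs" "set xs \<subseteq> {0..w}"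
    and C: "same_kernel (map C es) cs" and S: "same_kernel (map S es) ss"
  shows "realizable w (set es) R C S"
proof -
  let ?m = "length es"
  have len: "length xs = ?m" "length cs = ?m" "length ss = ?m"
    using R C S by (auto simp: same_kernel_iff_nth)
  obtain ys where ys: "length ys = ?m" "set ys \<subseteq> {0..w}"
    and cp: "\<And>i j. i < ?m \<Longrightarrow> j < i \<Longrightarrow> consistent w (xs ! i, ys ! i, cs ! i, ss ! i) (xs ! j, ys ! j, cs ! j, ss ! j)"
    using completable_sound[OF sol] len by auto
  define zs where "zs = map (\<lambda>i. - (xs ! i + ys ! i)) [0..<?m]"
  have zs: "length zs = ?m" "\<And>i. i < ?m \<Longrightarrow> zs ! i = - (xs ! i + ys ! i)"
    by (auto simp: zs_def)
  have mem: "xs ! i \<in> {0..w}" "ys ! i \<in> {0..w}" if "i < ?m" for i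
    using R(2) ys len that nth_mem[of i xs] nth_mem[of i ys] by (simp_all add: subset_iff)
  \<comment> \<open>The search compares a cell with earlier ones only; consistency is symmetric.\<close>
  have cp': "consistent w (xs ! i, ys ! i, cs ! i, ss ! i) (xs ! j, ys ! j, cs ! j, ss ! j)"
    if "i < ?m" "j < ?m" for i j
  proof (cases i j rule: linorder_cases)
    case less
    then show ?thesis using cp[OF that(2) less] by (simp add: consistent_def) linarith
  next
    case equal
    then show ?thesis using mem[OF that(1)] by (simp add: consistent_def)
  next
    case greater
    then show ?thesis using cp[OF that(1) greater] by simp
  qed
  have bd: "xs ! i \<le> xs ! j + w" "ys ! i \<le> ys ! j + w" if "i < ?m" "j < ?m" for i j
    using mem[OF that(1)] mem[OF that(2)] by auto
  have "tight w (set es) R (\<lambda>a. the (map_of (zip es xs) a))"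
    using R bd len by (intro tight_nth[OF _ es]) (auto simp: same_kernel_iff_nth)
  moreover have "tight w (set es) C (\<lambda>a. the (map_of (zip es ys) a))"
    using C cp' bd ys len by (intro tight_nth[OF _ es]) (auto simp: same_kernel_iff_nth consistent_def)
  moreover have "tight w (set es) S (\<lambda>a. the (map_of (zip es zs) a))"
  proof (intro tight_nth[OF zs(1) es] conjI)
    fix i j assume ij: "i < ?m" "j < ?m"
    have "S (es ! i) = S (es ! j) \<longleftrightarrow> ss ! i = ss ! j"
      using S ij by (simp add: same_kernel_iff_nth)
    then show "zs ! i = zs ! j \<longleftrightarrow> S (es ! i) = S (es ! j)" "zs ! i \<le> zs ! j + w"
      using cp'[OF ij] ij by (auto simp: zs consistent_def)
  qed
  moreover have "the (map_of (zip es xs) a) + the (map_of (zip es ys) a) + the (map_of (zip es zs) a) = 0"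
    if "a \<in> set es" for a
    using that len ys es by (auto simp: in_set_conv_nth map_of_zip_nth zs)
  ultimately show ?thesis unfolding realizable_def by blast
qed

text \<open>The executable counterpart of \<open>intercalate\<close> for a list of cells.\<close>

definition list_intercalate :: "('a \<times> 'b \<times> 'c) list \<Rightarrow> bool" where
  "list_intercalate ts \<longleftrightarrow> list_ex (\<lambda>(r1, c1, s1). list_ex (\<lambda>(r2, c2, s2).
     r2 = r1 \<and> c2 \<noteq> c1 \<and> s2 \<noteq> s1 \<and>
     list_ex (\<lambda>(r3, c3, s3). r3 \<noteq> r1 \<and> c3 = c1 \<and> s3 = s2 \<and>
       list_ex (\<lambda>(r4, c4, s4). r4 = r3 \<and> c4 = c2 \<and> s4 = s1) ts) ts) ts) ts"

lemma list_intercalate_imp_intercalate: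
  assumes cr: "list_intercalate (zip rs (zip cs ss))"
    and "same_kernel (map R es) rs" "same_kernel (map C es) cs" "same_kernel (map S es) ss"
  shows "intercalate (set es) R C S"
proof -
  have len: "length rs = length es" "length cs = length es" "length ss = length es"
    using assms by (auto simp: same_kernel_iff_nth)
  have ker: "rs ! i = rs ! j \<longleftrightarrow> R (es ! i) = R (es ! j)" "cs ! i = cs ! j \<longleftrightarrow> C (es ! i) = C (es ! j)"
      "ss ! i = ss ! j \<longleftrightarrow> S (es ! i) = S (es ! j)" if "i < length es" "j < length es" for i j
    using assms that by (auto simp: same_kernel_iff_nth)
  have idx: "\<exists>i<length es. r = rs ! i \<and> c = cs ! i \<and> s = ss ! i"
    if "(r, c, s) \<in> set (zip rs (zip cs ss))" for r c s
    using that len by (auto simp: set_zip)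
  from cr obtain r1 c1 s1 r2 c2 s2 r3 c3 s3 r4 c4 s4 where
    t: "(r1, c1, s1) \<in> set (zip rs (zip cs ss))" "(r2, c2, s2) \<in> set (zip rs (zip cs ss))"
       "(r3, c3, s3) \<in> set (zip rs (zip cs ss))" "(r4, c4, s4) \<in> set (zip rs (zip cs ss))"
    and eqs: "r2 = r1" "c2 \<noteq> c1" "s2 \<noteq> s1" "r3 \<noteq> r1" "c3 = c1" "s3 = s2" "r4 = r3" "c4 = c2" "s4 = s1"
    by (fastforce simp: list_intercalate_def list_ex_iff)
  from idx[OF t(1)] idx[OF t(2)] idx[OF t(3)] idx[OF t(4)] obtain i j k l where
    "i < length es" "r1 = rs ! i" "c1 = cs ! i" "s1 = ss ! i"
    "j < length es" "r2 = rs ! j" "c2 = cs ! j" "s2 = ss ! j"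
    "k < length es" "r3 = rs ! k" "c3 = cs ! k" "s3 = ss ! k"
    "l < length es" "r4 = rs ! l" "c4 = cs ! l" "s4 = ss ! l"
    by blast
  then have "R (es ! i) = R (es ! j) \<and> R (es ! k) = R (es ! l) \<and> R (es ! i) \<noteq> R (es ! k) \<and>
     C (es ! i) = C (es ! k) \<and> C (es ! j) = C (es ! l) \<and> C (es ! i) \<noteq> C (es ! j) \<and>
     S (es ! i) = S (es ! l) \<and> S (es ! j) = S (es ! k) \<and> S (es ! i) \<noteq> S (es ! j)"
    using eqs by (metis ker)
  then show ?thesis
    unfolding intercalate_def using \<open>i < _\<close> \<open>j < _\<close> \<open>k < _\<close> \<open>l < _\<close> nth_mem by blast
qed

section \<open>Squares without an intercalate\<close>

text \<open>For each partition type of at least 2 and at most 5 cells into rows there is a list of row labels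
  to be tried in turn. No single one serves all columns and symbols for the types \<open>3+1+1\<close> and
  \<open>2+2+1\<close>. The choice among the possible labels is made so as to keep the backtracking short.\<close>

definition row_labels :: "int list list list" where
  "row_labels =
    [[[0,0]], [[0,1]],
     [[0,0,0]], [[1,1,0]], [[1,0,2]],
     [[0,0,0,0]], [[1,1,1,0]], [[1,1,0,0]], [[2,2,0,1]], [[2,3,4,0]],
     [[0,0,0,0,0]], [[1,1,1,1,0]], [[1,1,1,0,0]], [[2,2,2,0,1], [1,1,1,2,0]],
     [[2,2,0,0,1], [1,1,0,0,2], [2,2,1,1,0]], [[3,3,0,2,1]], [[2,4,3,5,0]]]"

lemma row_labels_wf:
  "list_all (\<lambda>L. list_all (\<lambda>x. same_kernel (hd L) x \<and>
     list_all (\<lambda>v. 0 \<le> v \<and> v \<le> int (length x)) x) L) row_labels"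
  by code_simp

lemma row_labels_complete:
  "list_all (\<lambda>m. list_all (\<lambda>p.
     list_ex (\<lambda>L. same_kernel (map ((!) p) (reorder p)) (hd L)) row_labels) (patterns m)) [2,3,4,5]"
  by code_simp

text \<open>The three \<open>distinct\<close> conditions express that two cells share at most one coordinate. Restricting to
  at least as many columns and symbols as rows is harmless by symmetry and keeps the
  number of cases small.\<close>

definition extends_to_all :: "int list list \<Rightarrow> bool" where
  "extends_to_all L = (let r = hd L; m = length r;
       ps = filter (\<lambda>c. distinct (zip r c) \<and> length (remdups r) \<le> length (remdups c)) (patterns m) in
     list_all (\<lambda>c. list_all (\<lambda>s. \<not> distinct (zip c s) \<or>
       list_ex (\<lambda>x. completable (int m) [] (zip x (zip c s))) L \<or> list_intercalate (zip r (zip c s))) ps) ps)"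

lemma row_labels_extend: "list_all extends_to_all row_labels"
  by code_simp

lemma distinct_zip_kernels:
  assumes "inj_on (\<lambda>a. (R a, C a)) (set es)" "distinct es"
    and "same_kernel (map R es) rs" "same_kernel (map C es) cs"
  shows "distinct (zip rs cs)"
  using assms unfolding same_kernel_iff_nth distinct_conv_nth inj_on_def
  by simp (metis nth_mem)

text \<open>The cells are enumerated so that their row partition is one of those in \<open>row_labels\<close>; then the
  column and symbol lists are replaced by their patterns, to which the search applies.\<close>

lemma realizable_coarsest_rows:
  assumes A: "finite A" "card A \<in> {2..5}" and lat: "latin A R C S" and ni: "\<not> intercalate A R C S"
    and le: "card (R ` A) \<le> card (C ` A)" "card (R ` A) \<le> card (S ` A)"
  shows "realizable (int (card A)) A R C S"
proof -
  obtain ds where ds: "set ds = A" "distinct ds"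
    using A finite_distinct_list by blast
  have lds: "length ds = card A" using ds distinct_card by fastforce
  obtain p where p: "p \<in> set (patterns (card A))" "same_kernel (map R ds) p"
    using patterns_complete[of "map R ds"] lds by auto
  have lp: "length p = card A" using p lds by (simp add: same_kernel_iff_nth)
  define es where "es = map ((!) ds) (reorder p)"
  have es: "set es = A"
    using ds lds lp by (auto simp: es_def set_reorder in_set_conv_nth)
  have des: "distinct es"
    using ds lds lp by (simp add: es_def set_reorder distinct_reorder distinct_map inj_on_nth)
  have les: "length es = card A" using es des distinct_card by fastforce
  have "card A = 2 \<or> card A = 3 \<or> card A = 4 \<or> card A = 5" using A by auto
  then have "\<exists>L\<in>set row_labels. same_kernel (map ((!) p) (reorder p)) (hd L)"
    using row_labels_complete p(1) by (auto simp: list_all_iff list_ex_iff)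
  then obtain L where L: "L \<in> set row_labels" "same_kernel (map ((!) p) (reorder p)) (hd L)"
    by blast
  have "same_kernel (map R es) (map ((!) p) (reorder p))"
  proof -
    have "reorder p ! i < length ds" if "i < length (reorder p)" for i
      using that set_reorder[of p] nth_mem lp lds by fastforce
    then show ?thesis
      using p(2) by (simp add: same_kernel_iff_nth es_def)
  qed
  from same_kernel_trans[OF this L(2)] have R: "same_kernel (map R es) (hd L)" .
  have lL: "length (hd L) = card A" using R les by (simp add: same_kernel_iff_nth)
  obtain c where c: "c \<in> set (patterns (card A))" "same_kernel (map C es) c"
    using patterns_complete[of "map C es"] les by auto
  obtain s where s: "s \<in> set (patterns (card A))" "same_kernel (map S es) s"
    using patterns_complete[of "map S es"] les by auto
  have "distinct (zip (hd L) c)" "length (remdups (hd L)) \<le> length (remdups c)"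
    "distinct (zip (hd L) s)" "length (remdups (hd L)) \<le> length (remdups s)" "distinct (zip c s)"
    using lat le es des same_kernel_card[OF R] same_kernel_card[OF c(2)] same_kernel_card[OF s(2)]
      distinct_zip_kernels[OF _ des R c(2)] distinct_zip_kernels[OF _ des R s(2)]
      distinct_zip_kernels[OF _ des c(2) s(2)]
    by (auto simp: latin_def length_remdups_card_conv)
  moreover have "\<not> list_intercalate (zip (hd L) (zip c s))"
    using list_intercalate_imp_intercalate[OF _ R c(2) s(2)] ni es by blast
  moreover have "extends_to_all L"
    using row_labels_extend L(1) by (simp add: list_all_iff)
  ultimately have "\<exists>x\<in>set L. completable (int (card A)) [] (zip x (zip c s))"
    using c(1) s(1) lL by (simp add: extends_to_all_def Let_def list_all_iff list_ex_iff) blast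
  then obtain x where x: "x \<in> set L" "completable (int (card A)) [] (zip x (zip c s))"
    by blast
  have wf: "same_kernel (hd L) x" "set x \<subseteq> {0..int (length x)}"
    using row_labels_wf L(1) x(1) by (fastforce simp: list_all_iff)+
  then have "length x = card A" using lL by (simp add: same_kernel_iff_nth)
  then show ?thesis
    using realizable_if_completable[OF x(2) des same_kernel_trans[OF R wf(1)] _ c(2) s(2)] wf(2) es
    by simp
qed

text \<open>By symmetry the coordinate with the fewest values may be taken for the rows.\<close>

theorem realizable_of_no_intercalate:
  assumes A: "finite A" "card A \<in> {2..5}" and lat: "latin A R C S" and ni: "\<not> intercalate A R C S"
  shows "realizable (int (card A)) A R C S"
proof -
  consider "card (R ` A) \<le> card (C ` A)" "card (R ` A) \<le> card (S ` A)"
    | "card (C ` A) \<le> card (R ` A)" "card (C ` A) \<le> card (S ` A)"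
    | "card (S ` A) \<le> card (C ` A)" "card (S ` A) \<le> card (R ` A)"
    by linarith
  then show ?thesis
  proof cases
    case 1
    then show ?thesis using assms realizable_coarsest_rows by blast
  next
    case 2
    have "\<not> intercalate A C R S" using ni intercalate_swap12 by blast
    with 2 show ?thesis
      using A latin_swap12[OF lat] realizable_coarsest_rows realizable_swap12 by blast
  next
    case 3
    have "\<not> intercalate A S C R" using ni intercalate_swap13 by blast
    with 3 show ?thesis
      using A latin_swap13[OF lat] realizable_coarsest_rows realizable_swap13 by blast
  qed
qed

lemma represents_mod_of_no_intercalate:
  assumes A: "finite A" "card A \<in> {2..5}" "card A < n" and lat: "latin A R C S" "\<not> intercalate A R C S"
  shows "\<exists>x y z. represents_mod (int n) A R x \<and> represents_mod (int n) A C y \<and>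
        represents_mod (int n) A S z \<and> (\<forall>i\<in>A. (x i + y i + z i) mod int n = 0)"
proof -
  obtain x y z where "tight (int (card A)) A R x" "tight (int (card A)) A C y" "tight (int (card A)) A S z"
    "\<forall>i\<in>A. x i + y i + z i = 0"
    using realizable_of_no_intercalate[OF A(1,2) lat] unfolding realizable_def by blast
  moreover have "int (card A) < int n" using A by simp
  ultimately show ?thesis using tight_imp_represents_mod by (metis mod_0)
qed

section \<open>An intercalate and one more cell\<close>

text \<open>The labels of the three values \<open>p\<close>, \<open>q\<close> and \<open>u\<close> that a coordinate takes when a cell is added to an
  intercalate.\<close>

definition half_label :: "int \<Rightarrow> 'b \<Rightarrow> 'b \<Rightarrow> int \<Rightarrow> 'b \<Rightarrow> int" where
  "half_label h p q t u = (if u = p then 0 else if u = q then h else t)"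

lemma represents_mod_half_label:
  assumes "h > 0" "p \<noteq> q" "\<And>i. i \<in> A \<Longrightarrow> R i \<in> {p, q, u}"
    and "u \<notin> {p, q} \<Longrightarrow> t mod (2 * h) \<noteq> 0 \<and> t mod (2 * h) \<noteq> h"
  shows "represents_mod (2 * h) A R (\<lambda>i. half_label h p q t (R i))"
  unfolding represents_mod_def
proof (intro ballI)
  fix i j assume "i \<in> A" "j \<in> A"
  then have "R i \<in> {p, q, u}" "R j \<in> {p, q, u}" using assms(3) by blast+
  moreover have "h mod (2 * h) = h" "h \<noteq> 0" using assms(1) by simp_all
  ultimately show "half_label h p q t (R i) mod (2 * h) = half_label h p q t (R j) mod (2 * h) \<longleftrightarrow> R i = R j"
    using assms(2,4) by (auto simp: half_label_def)
qed

text \<open>Each cell of the intercalate has the label \<open>h\<close> in none or in exactly two of its coordinates and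
  \<open>0\<close> in the others, so its sum is \<open>0\<close> modulo \<open>2 h\<close>. Any row and any column of the intercalate, and likewise for the other pairs of coordinates, already
  occur together in one of its cells. Hence the fifth cell \<open>e\<close> has at least two new
  coordinates. All new ones but one are labelled by \<open>1\<close>, and the sum condition then determines the last label; it is
  different from \<open>0\<close> and \<open>h\<close> modulo \<open>2 h\<close>.\<close>

lemma intercalate_plus_one:
  fixes R :: "'a \<Rightarrow> 'b" and C :: "'a \<Rightarrow> 'c" and S :: "'a \<Rightarrow> 'd"
  assumes h: "h \<ge> 3" and A: "finite A" "card A = 5" and lat: "latin A R C S" and ic: "intercalate A R C S"
  shows "\<exists>x y z. represents_mod (2 * h) A R x \<and> represents_mod (2 * h) A C y \<and>
    represents_mod (2 * h) A S z \<and> (\<forall>i\<in>A. (x i + y i + z i) mod (2 * h) = 0)"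
proof -
  obtain a b c d where abcd: "a \<in> A" "b \<in> A" "c \<in> A" "d \<in> A"
    and R: "R b = R a" "R d = R c" "R c \<noteq> R a"
    and C: "C c = C a" "C d = C b" "C b \<noteq> C a"
    and S: "S d = S a" "S c = S b" "S b \<noteq> S a"
    using ic unfolding intercalate_def by metis
  have dist: "distinct [a, b, c, d]" using R C S by auto
  then have "card {a, b, c, d} = 4" by simp
  then have "card (A - {a, b, c, d}) = 1"
    using A abcd by (subst card_Diff_subset) auto
  then obtain e where e: "A - {a, b, c, d} = {e}" by (auto simp: card_1_singleton_iff)
  have Aeq: "A = {a, b, c, d, e}" and enot: "e \<notin> {a, b, c, d}" using e abcd by auto
  have RC: "R i \<noteq> R j \<or> C i \<noteq> C j" and RS: "R i \<noteq> R j \<or> S i \<noteq> S j" and CS: "C i \<noteq> C j \<or> S i \<noteq> S j"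
    if "i \<in> A" "j \<in> A" "i \<noteq> j" for i j
    using lat that unfolding latin_def inj_on_def by blast+
  have e4: "e \<in> A" "e \<noteq> a" "e \<noteq> b" "e \<noteq> c" "e \<noteq> d" using Aeq enot by auto
  note sep = RC[OF e4(1) abcd(1) e4(2)] RC[OF e4(1) abcd(2) e4(3)] RC[OF e4(1) abcd(3) e4(4)] RC[OF e4(1) abcd(4) e4(5)]
    RS[OF e4(1) abcd(1) e4(2)] RS[OF e4(1) abcd(2) e4(3)] RS[OF e4(1) abcd(3) e4(4)] RS[OF e4(1) abcd(4) e4(5)]
    CS[OF e4(1) abcd(1) e4(2)] CS[OF e4(1) abcd(2) e4(3)] CS[OF e4(1) abcd(3) e4(4)] CS[OF e4(1) abcd(4) e4(5)]
  let ?x = "\<lambda>t i. half_label h (R a) (R c) t (R i)" and ?y = "\<lambda>t i. half_label h (C a) (C b) t (C i)"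
    and ?z = "\<lambda>t i. half_label h (S a) (S b) t (S i)"
  define fresh where "fresh t \<longleftrightarrow> t mod (2 * h) \<noteq> 0 \<and> t mod (2 * h) \<noteq> h" for t
  have freshI: "fresh t" if "0 < t + 2 * h * k" "t + 2 * h * k < 2 * h" "t + 2 * h * k \<noteq> h" for t k
  proof -
    have "t mod (2 * h) = (t + 2 * h * k) mod (2 * h)" by simp
    also have "\<dots> = t + 2 * h * k" using that by (intro mod_pos_pos_trivial) auto
    finally show ?thesis using that by (simp add: fresh_def)
  qed
  have fresh: "fresh 1" "fresh (-1)" "fresh (-1 - h)" "fresh (-2)"
    using h by (auto intro: freshI[where k = 0] freshI[where k = 1])
  \<comment> \<open>At most one coordinate of \<open>e\<close> is old; its label is fixed and its parameter is arbitrary.\<close>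
  obtain t u v where tuv: "R e \<notin> {R a, R c} \<Longrightarrow> fresh t" "C e \<notin> {C a, C b} \<Longrightarrow> fresh u"
      "S e \<notin> {S a, S b} \<Longrightarrow> fresh v" and sum_e: "?x t e + ?y u e + ?z v e = 0"
  proof -
    consider "R e \<in> {R a, R c}" "C e \<notin> {C a, C b}" "S e \<notin> {S a, S b}"
      | "R e \<notin> {R a, R c}" "C e \<in> {C a, C b}" "S e \<notin> {S a, S b}"
      | "R e \<notin> {R a, R c}" "C e \<notin> {C a, C b}" "S e \<in> {S a, S b}"
      | "R e \<notin> {R a, R c}" "C e \<notin> {C a, C b}" "S e \<notin> {S a, S b}"
      using sep R C S by (smt (verit) insert_iff empty_iff)
    then show thesis
    proof cases
      case 1
      then show ?thesis
        using fresh by (intro that[of 0 1 "- 1 - ?x 0 e"]) (auto simp: half_label_def)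
    next
      case 2
      then show ?thesis
        using fresh by (intro that[of 1 0 "- 1 - ?y 0 e"]) (auto simp: half_label_def)
    next
      case 3
      then show ?thesis
        using fresh by (intro that[of 1 "- 1 - ?z 0 e" 0]) (auto simp: half_label_def)
    next
      case 4
      then show ?thesis
        using fresh by (intro that[of 1 1 "-2"]) (auto simp: half_label_def)
    qed
  qed
  have "represents_mod (2 * h) A R (?x t)"
    by (rule represents_mod_half_label[where u = "R e"]) (use h R Aeq tuv fresh_def in auto)
  moreover have "represents_mod (2 * h) A C (?y u)"
    by (rule represents_mod_half_label[where u = "C e"]) (use h C Aeq tuv fresh_def in auto)
  moreover have "represents_mod (2 * h) A S (?z v)"
    by (rule represents_mod_half_label[where u = "S e"]) (use h S Aeq tuv fresh_def in auto)
  moreover have "(?x t i + ?y u i + ?z v i) mod (2 * h) = 0" if "i \<in> A" for i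
  proof (cases "i = e")
    case True
    then show ?thesis using sum_e by simp
  next
    case False
    then have "i = a \<or> i = b \<or> i = c \<or> i = d" using that Aeq by blast
    then consider "i = a" | "i = b" | "i = c" | "i = d" by blast
    then show ?thesis using R C S by cases (simp_all add: half_label_def)
  qed
  ultimately show ?thesis by blast
qed

section \<open>Reduction to consecutive sizes\<close>

definition always_embeds :: "nat \<Rightarrow> nat \<Rightarrow> bool" where
  "always_embeds n m \<longleftrightarrow> (\<forall>P :: nat partial_matrix. is_PLS P \<and> PLS_size P = m \<longrightarrow>
     (\<exists>G :: int monoid. comm_group G \<and> order G = n \<and> embeds_in P G))"

lemma not_always_embedsI:
  fixes P :: "nat partial_matrix"
  assumes "is_PLS P" "PLS_size P = m"
    and "\<And>G :: int monoid. comm_group G \<Longrightarrow> order G = n \<Longrightarrow> embeds_in P G \<Longrightarrow> False"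
  shows "\<not> always_embeds n m"
proof
  assume "always_embeds n m"
  then obtain G :: "int monoid" where "comm_group G" "order G = n" "embeds_in P G"
    using assms(1,2) unfolding always_embeds_def by blast
  then show False by (rule assms(3))
qed

text \<open>Any symbol may be put into a cell at the crossing of a new row and a new column; an embedding
  of the larger square restricts to the given one.\<close>

lemma always_embeds_if_Suc:
  assumes "always_embeds n (Suc m)"
  shows "always_embeds n m"
  unfolding always_embeds_def
proof (intro allI impI, elim conjE)
  fix P :: "nat partial_matrix"
  assume P: "is_PLS P" "PLS_size P = m"
  define Q where "Q = \<lparr>nrows = Suc (nrows P), ncols = Suc (ncols P),
    entry = (\<lambda>i j. if i < nrows P \<and> j < ncols P then entry P i j
                    else if i = nrows P \<and> j = ncols P then Some 0 else None)\<rparr>"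
  have cells: "filled_cells Q = insert (nrows P, ncols P) (filled_cells P)"
    by (auto simp: filled_cells_def Q_def less_Suc_eq split: if_splits)
  have new: "(nrows P, ncols P) \<notin> filled_cells P" by (simp add: filled_cells_def)
  have size: "PLS_size Q = Suc m"
    using P new by (simp add: PLS_size_def cells finite_filled_cells)
  have old: "entry Q i j = entry P i j" "i < nrows P" "j < ncols P" if "(i, j) \<in> filled_cells P" for i j
    using that by (auto simp: filled_cells_def Q_def)
  have rowP: "entry P i j \<noteq> entry P i j'"
    if "(i, j) \<in> filled_cells P" "(i, j') \<in> filled_cells P" "j \<noteq> j'" for i j j'
    using P(1) that unfolding is_PLS_def by blast
  have colP: "entry P i j \<noteq> entry P i' j"
    if "(i, j) \<in> filled_cells P" "(i', j) \<in> filled_cells P" "i \<noteq> i'" for i i' j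
    using P(1) that unfolding is_PLS_def by blast
  have PLS: "is_PLS Q"
    unfolding is_PLS_def
  proof (intro conjI allI impI, goal_cases)
    case (1 i j j')
    then show ?case using rowP[of i j j'] old[of i j] old[of i j'] unfolding cells by auto
  next
    case (2 i i' j)
    then show ?case using colP[of i j i'] old[of i j] old[of i' j] unfolding cells by auto
  next
    case (3 i)
    then have "i < nrows P \<or> i = nrows P" by (auto simp: Q_def)
    then show ?case using P(1) unfolding cells is_PLS_def by blast
  next
    case (4 j)
    then have "j < ncols P \<or> j = ncols P" by (auto simp: Q_def)
    then show ?case using P(1) unfolding cells is_PLS_def by blast
  qed
  obtain G :: "int monoid" where G: "comm_group G" "order G = n" "embeds_in Q G"
    using assms PLS size unfolding always_embeds_def by blast
  from G(3) obtain f g h where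
    "f \<in> {..<nrows Q} \<rightarrow> carrier G" "inj_on f {..<nrows Q}"
    "g \<in> {..<ncols Q} \<rightarrow> carrier G" "inj_on g {..<ncols Q}"
    "h \<in> symbols Q \<rightarrow> carrier G" "inj_on h (symbols Q)"
    and eq: "\<forall>r<nrows Q. \<forall>c<ncols Q. \<forall>s. entry Q r c = Some s \<longrightarrow> f r \<otimes>\<^bsub>G\<^esub> g c = h s"
    unfolding embeds_in_def by blast
  moreover have sub: "{..<nrows P} \<subseteq> {..<nrows Q}" "{..<ncols P} \<subseteq> {..<ncols Q}"
    by (auto simp: Q_def)
  moreover have "symbols P \<subseteq> symbols Q"
  proof
    fix u assume "u \<in> symbols P"
    then obtain i j where "i < nrows P" "j < ncols P" "entry P i j = Some u"
      by (auto simp: symbols_def)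
    then show "u \<in> symbols Q"
      by (intro symbolsI[of i _ j]) (auto simp: Q_def)
  qed
  moreover have "\<forall>r<nrows P. \<forall>c<ncols P. \<forall>s. entry P r c = Some s \<longrightarrow> f r \<otimes>\<^bsub>G\<^esub> g c = h s"
    using eq by (simp add: Q_def)
  ultimately have "embeds_in P G"
    unfolding embeds_in_def
    by (intro exI[of _ f] exI[of _ g] exI[of _ h] conjI) (auto intro: inj_on_subset)
  then show "\<exists>G :: int monoid. comm_group G \<and> order G = n \<and> embeds_in P G"
    using G by blast
qed

lemma psi_plus_eqI:
  assumes "always_embeds n m" "\<not> always_embeds n (Suc m)"
  shows "psi_plus n = m"
proof -
  have "\<not> always_embeds n k" if "Suc m \<le> k" for k
    using that by (induction k rule: dec_induct) (use assms(2) always_embeds_if_Suc in blast)+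
  then have "k \<le> m" if "always_embeds n k" for k
    using that not_less_eq_eq by blast
  then show ?thesis
    unfolding psi_plus_def always_embeds_def[symmetric]
    using assms(1) by (intro Greatest_equality) auto
qed

text \<open>Cyclic groups suffice for all lower bounds, so that it remains to find labels for the cells.\<close>

lemma always_embedsI:
  assumes "n > 0"
    and "\<And>A (S :: nat \<times> nat \<Rightarrow> nat). finite A \<Longrightarrow> card A = m \<Longrightarrow> latin A fst snd S \<Longrightarrow>
      \<exists>x y z. represents_mod (int n) A fst x \<and> represents_mod (int n) A snd y \<and>
        represents_mod (int n) A S z \<and> (\<forall>i\<in>A. (x i + y i + z i) mod int n = 0)"
  shows "always_embeds n m"
  unfolding always_embeds_def
proof (intro allI impI, elim conjE)
  fix P :: "nat partial_matrix"
  assume P: "is_PLS P" "PLS_size P = m"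
  have "embeds_in P (integer_mod_group n)"
    using assms(2)[OF finite_filled_cells _ PLS_latin[OF P(1)]] P(2)
      embeds_in_cyclic_group[OF P(1) assms(1) refl] unfolding PLS_size_def by blast
  moreover have "order (integer_mod_group n) = n"
    using assms(1) by (simp add: order_def carrier_integer_mod_group)
  ultimately show "\<exists>G :: int monoid. comm_group G \<and> order G = n \<and> embeds_in P G"
    using abelian_integer_mod_group by blast
qed

section \<open>Sizes that always embed\<close>

lemma always_embeds_1: "n > 0 \<Longrightarrow> always_embeds n 1"
  by (rule always_embedsI) (auto simp: card_1_singleton_iff represents_mod_def intro!: exI[of _ "\<lambda>_. 0"])

lemma always_embeds_small:
  assumes "m \<in> {2, 3}" "m < n"
  shows "always_embeds n m"
proof (rule always_embedsI)
  fix A and S :: "nat \<times> nat \<Rightarrow> nat"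
  assume A: "finite A" "card A = m" "latin A fst snd S"
  then have "\<not> intercalate A fst snd S"
    using intercalate_card[of A fst snd S] assms by auto
  then show "\<exists>x y z. represents_mod (int n) A fst x \<and> represents_mod (int n) A snd y \<and>
        represents_mod (int n) A S z \<and> (\<forall>i\<in>A. (x i + y i + z i) mod int n = 0)"
    using represents_mod_of_no_intercalate[of A n] A assms by auto
qed (use assms in auto)

lemma always_embeds_5:
  assumes "even n" "n > 5"
  shows "always_embeds n 5"
proof (rule always_embedsI)
  fix A and S :: "nat \<times> nat \<Rightarrow> nat"
  assume A: "finite A" "card A = 5" "latin A fst snd S"
  obtain h where h: "n = 2 * h" using assms by blast
  show "\<exists>x y z. represents_mod (int n) A fst x \<and> represents_mod (int n) A snd y \<and>
        represents_mod (int n) A S z \<and> (\<forall>i\<in>A. (x i + y i + z i) mod int n = 0)"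
  proof (cases "intercalate A fst snd S")
    case True
    then show ?thesis
      using intercalate_plus_one[OF _ A True, of "int h"] h assms by simp
  next
    case False
    then show ?thesis
      using represents_mod_of_no_intercalate[of A n] A assms by auto
  qed
qed (use assms in auto)

section \<open>Squares that do not embed\<close>

definition diagonal_matrix :: "nat \<Rightarrow> nat partial_matrix" where
  "diagonal_matrix k = \<lparr>nrows = k, ncols = k,
     entry = (\<lambda>i j. if i = j then Some (if Suc i = k then 1 else 0) else None)\<rparr>"

text \<open>The group element \<open>f' i\<close> is the only one whose product with the image \<open>g i\<close> of column \<open>i\<close> is \<open>s 0\<close>,
  the image of the repeated symbol. All elements of the group are images of rows, so for the last
  column it belongs to some row. This cannot be an earlier row, whose product with another
  column is \<open>s 0\<close>, nor the last row, where the symbol is different.\<close>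

lemma not_always_embeds_diagonal:
  assumes "0 < n" "n \<le> k" "2 \<le> k"
  shows "\<not> always_embeds n k"
proof (rule not_always_embedsI)
  have cells: "filled_cells (diagonal_matrix k) = (\<lambda>i. (i, i)) ` {..<k}"
    by (auto simp: filled_cells_def diagonal_matrix_def split: if_splits)
  then show "PLS_size (diagonal_matrix k) = k"
    by (simp add: PLS_size_def card_image inj_on_def)
  show "is_PLS (diagonal_matrix k)"
    unfolding is_PLS_def cells by (auto simp: diagonal_matrix_def)
next
  fix G :: "int monoid"
  assume "comm_group G" "order G = n" and emb: "embeds_in (diagonal_matrix k) G"
  interpret comm_group G by fact
  obtain f g s where f: "f \<in> {..<k} \<rightarrow> carrier G" "inj_on f {..<k}"
      and g: "g \<in> {..<k} \<rightarrow> carrier G" "inj_on g {..<k}"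
      and s: "s \<in> symbols (diagonal_matrix k) \<rightarrow> carrier G" "inj_on s (symbols (diagonal_matrix k))"
      and eq: "\<And>i. i < k \<Longrightarrow> f i \<otimes>\<^bsub>G\<^esub> g i = s (if Suc i = k then 1 else 0)"
    using emb unfolding embeds_in_def by (auto simp: diagonal_matrix_def)
  have sym: "0 \<in> symbols (diagonal_matrix k)" "1 \<in> symbols (diagonal_matrix k)"
    using assms by (auto simp: symbols_def diagonal_matrix_def intro: exI[of _ 0] exI[of _ "k - 1"])
  have s0: "s 0 \<in> carrier G" "s 0 \<noteq> s 1"
    using s sym by (auto dest: inj_onD)
  define f' where "f' i = s 0 \<otimes>\<^bsub>G\<^esub> inv\<^bsub>G\<^esub> g i" for i
  have "card (f ` {..<k}) = k" using f(2) by (simp add: card_image)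
  moreover have "finite (carrier G)"
    using assms(1) \<open>order G = n\<close> by (auto simp: order_def intro: card_ge_0_finite)
  ultimately have "f ` {..<k} = carrier G"
    using f(1) assms(2) \<open>order G = n\<close> by (intro card_seteq) (auto simp: order_def)
  moreover have last: "k - 1 < k" using assms by simp
  moreover have "f' (k - 1) \<in> carrier G"
    using s0 g(1) last unfolding f'_def by auto
  ultimately obtain i where i: "i < k" "f i = f' (k - 1)" by (metis imageE lessThan_iff)
  have gi: "g i \<in> carrier G" "g (k - 1) \<in> carrier G" "f i \<in> carrier G"
    using g(1) f(1) i(1) last by auto
  have "f i \<otimes>\<^bsub>G\<^esub> g (k - 1) = s 0"
    using i(2) gi s0 by (simp add: f'_def m_assoc)
  show False
  proof (cases "Suc i = k")
    case True
    then have "i = k - 1" by simp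
    then show False using \<open>f i \<otimes>\<^bsub>G\<^esub> g (k - 1) = s 0\<close> eq[OF i(1)] True s0 by simp
  next
    case False
    then have "f i \<otimes>\<^bsub>G\<^esub> g (k - 1) = f i \<otimes>\<^bsub>G\<^esub> g i"
      using \<open>f i \<otimes>\<^bsub>G\<^esub> g (k - 1) = s 0\<close> eq[OF i(1)] by simp
    then have "g (k - 1) = g i" using gi by simp
    then show False using g(2) i last False by (auto dest: inj_onD)
  qed
qed

text \<open>In a group of order \<open>2 k + 1\<close>, every element is the power with exponent \<open>k + 1\<close> of its square.\<close>

lemma (in group) square_inj_odd_order:
  assumes "odd (order G)" "x \<in> carrier G" "y \<in> carrier G" "x \<otimes> x = y \<otimes> y"
  shows "x = y"
proof -
  obtain k where k: "order G = 2 * k + 1" using assms(1) oddE by blast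
  have root: "u = (u \<otimes> u) [^] Suc k" if "u \<in> carrier G" for u
  proof -
    have "u = u [^] (order G + 1)" using that pow_order_eq_1[OF that] by simp
    also have "order G + 1 = 2 * Suc k" using k by simp
    also have "u [^] (2 * Suc k) = (u [^] (2::nat)) [^] Suc k" using that by (simp only: nat_pow_pow)
    also have "u [^] (2::nat) = u \<otimes> u" using that by (simp add: numeral_2_eq_2)
    finally show ?thesis .
  qed
  show ?thesis using root[OF assms(2)] root[OF assms(3)] assms(4) by simp
qed

definition two_by_two :: "nat partial_matrix" where
  "two_by_two = \<lparr>nrows = 2, ncols = 2, entry = (\<lambda>i j. Some ((i + j) mod 2))\<rparr>"

text \<open>Multiplying the two equations of an intercalate shows that the two rows have equal squares.\<close>

lemma not_always_embeds_odd:
  assumes "odd n"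
  shows "\<not> always_embeds n 4"
proof (rule not_always_embedsI)
  have cells: "filled_cells two_by_two = {..<2} \<times> {..<2}"
    by (auto simp: filled_cells_def two_by_two_def)
  then show "PLS_size two_by_two = 4"
    by (simp add: PLS_size_def card_cartesian_product)
  show "is_PLS two_by_two"
    unfolding is_PLS_def cells by (auto simp: two_by_two_def less_2_cases_iff)
next
  fix G :: "int monoid"
  assume "comm_group G" and order: "order G = n" and emb: "embeds_in two_by_two G"
  interpret comm_group G by fact
  obtain f g s where f: "f \<in> {..<2::nat} \<rightarrow> carrier G" "inj_on f {..<2}"
      and g: "g \<in> {..<2::nat} \<rightarrow> carrier G"
      and eq: "\<And>i j. i < 2 \<Longrightarrow> j < 2 \<Longrightarrow> f i \<otimes>\<^bsub>G\<^esub> g j = s ((i + j) mod 2)"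
    using emb unfolding embeds_in_def by (auto simp: two_by_two_def)
  have mem: "f 0 \<in> carrier G" "f 1 \<in> carrier G" "g 0 \<in> carrier G" "g 1 \<in> carrier G"
    using f g by auto
  have "(f 0 \<otimes>\<^bsub>G\<^esub> f 0) \<otimes>\<^bsub>G\<^esub> (g 0 \<otimes>\<^bsub>G\<^esub> g 1) = (f 0 \<otimes>\<^bsub>G\<^esub> g 0) \<otimes>\<^bsub>G\<^esub> (f 0 \<otimes>\<^bsub>G\<^esub> g 1)"
    using mem by (simp add: m_ac)
  also have "\<dots> = (f 1 \<otimes>\<^bsub>G\<^esub> g 1) \<otimes>\<^bsub>G\<^esub> (f 1 \<otimes>\<^bsub>G\<^esub> g 0)"
    using eq[of 0 0] eq[of 0 1] eq[of 1 0] eq[of 1 1] by simp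
  also have "\<dots> = (f 1 \<otimes>\<^bsub>G\<^esub> f 1) \<otimes>\<^bsub>G\<^esub> (g 0 \<otimes>\<^bsub>G\<^esub> g 1)"
    using mem by (simp add: m_ac)
  finally have "f 0 \<otimes>\<^bsub>G\<^esub> f 0 = f 1 \<otimes>\<^bsub>G\<^esub> f 1"
    using mem by simp
  then have "f 0 = f 1" using square_inj_odd_order mem assms order by blast
  then show False using f(2) by (auto dest: inj_onD)
qed

text \<open>The rows are \<open>. 1 2\<close>, \<open>1 . 3\<close> and \<open>2 4 .\<close>: symmetric but for the entries \<open>3\<close> and \<open>4\<close>.\<close>

definition thomsen_matrix :: "nat partial_matrix" where
  "thomsen_matrix = \<lparr>nrows = 3, ncols = 3,
     entry = (\<lambda>i j. if i = j then None else Some (if i + j < 3 then i + j else i + 2))\<rparr>"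

lemma not_always_embeds_6: "\<not> always_embeds n 6"
proof (rule not_always_embedsI)
  have cells: "filled_cells thomsen_matrix = {(0,1), (0,2), (1,0), (1,2), (2,0), (2,1)}"
    by (auto simp: filled_cells_def thomsen_matrix_def)
  then show "PLS_size thomsen_matrix = 6"
    by (simp add: PLS_size_def)
  show "is_PLS thomsen_matrix"
    unfolding is_PLS_def
  proof (intro conjI allI impI, goal_cases)
    case (1 i j j')
    then show ?case
      by (auto simp: filled_cells_def thomsen_matrix_def split: if_splits)
  next
    case (2 i i' j)
    then show ?case
      by (auto simp: filled_cells_def thomsen_matrix_def split: if_splits)
  next
    case (3 i)
    then show ?case
      by (intro exI[of _ "if i = 0 then 1 else 0"]) (simp add: filled_cells_def thomsen_matrix_def)
  next
    case (4 j)
    then show ?case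
      by (intro exI[of _ "if j = 0 then 1 else 0"]) (simp add: filled_cells_def thomsen_matrix_def)
  qed
next
  fix G :: "int monoid"
  assume "comm_group G" and emb: "embeds_in thomsen_matrix G"
  interpret comm_group G by fact
  obtain f g s where f: "f \<in> {..<3::nat} \<rightarrow> carrier G"
      and g: "g \<in> {..<3::nat} \<rightarrow> carrier G"
      and s: "inj_on s (symbols thomsen_matrix)"
      and eq: "\<And>i j. i < 3 \<Longrightarrow> j < 3 \<Longrightarrow> i \<noteq> j \<Longrightarrow> f i \<otimes>\<^bsub>G\<^esub> g j = s (if i + j < 3 then i + j else i + 2)"
    using emb unfolding embeds_in_def by (auto simp: thomsen_matrix_def)
  have mem: "f 0 \<in> carrier G" "f 1 \<in> carrier G" "f 2 \<in> carrier G"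
      "g 0 \<in> carrier G" "g 1 \<in> carrier G" "g 2 \<in> carrier G"
    using f g by auto
  have "(f 0 \<otimes>\<^bsub>G\<^esub> g 0) \<otimes>\<^bsub>G\<^esub> (f 1 \<otimes>\<^bsub>G\<^esub> g 2) = (f 1 \<otimes>\<^bsub>G\<^esub> g 0) \<otimes>\<^bsub>G\<^esub> (f 0 \<otimes>\<^bsub>G\<^esub> g 2)"
    using mem by (simp add: m_ac)
  also have "\<dots> = (f 0 \<otimes>\<^bsub>G\<^esub> g 1) \<otimes>\<^bsub>G\<^esub> (f 2 \<otimes>\<^bsub>G\<^esub> g 0)"
    using eq[of 0 1] eq[of 1 0] eq[of 0 2] eq[of 2 0] by (simp add: numeral_2_eq_2)
  also have "\<dots> = (f 0 \<otimes>\<^bsub>G\<^esub> g 0) \<otimes>\<^bsub>G\<^esub> (f 2 \<otimes>\<^bsub>G\<^esub> g 1)"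
    using mem by (simp add: m_ac)
  finally have "f 1 \<otimes>\<^bsub>G\<^esub> g 2 = f 2 \<otimes>\<^bsub>G\<^esub> g 1"
    using mem by simp
  then have "s 3 = s 4" using eq[of 1 2] eq[of 2 1] by (simp add: eval_nat_numeral)
  moreover have "3 \<in> symbols thomsen_matrix" "4 \<in> symbols thomsen_matrix"
    by (rule symbolsI[of 1 _ 2], simp_all add: thomsen_matrix_def)
      (rule symbolsI[of 2 _ 1], simp_all add: thomsen_matrix_def)
  ultimately show False using s by (auto dest: inj_onD)
qed

section \<open>The values of psi\<close>

theorem theorem2:
  fixes n :: nat
  assumes "n > 0"
  shows "(n = 1 \<or> n = 2 \<longrightarrow> psi_plus n = 1) \<and>
         (n = 3 \<longrightarrow> psi_plus n = 2) \<and>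
         (n = 4 \<or> (odd n \<and> n > 3) \<longrightarrow> psi_plus n = 3) \<and>
         (even n \<and> n > 4 \<longrightarrow> psi_plus n = 5)"
proof (intro conjI impI)
  assume "n = 1 \<or> n = 2"
  then have "\<not> always_embeds n (Suc 1)"
    using not_always_embeds_diagonal[of n 2] assms by (auto simp: numeral_2_eq_2)
  then show "psi_plus n = 1" using psi_plus_eqI always_embeds_1 assms by blast
next
  assume "n = 3"
  then show "psi_plus n = 2"
    using psi_plus_eqI[of n 2] always_embeds_small[of 2 n] not_always_embeds_diagonal[of n 3] by simp
next
  assume n: "n = 4 \<or> (odd n \<and> n > 3)"
  then have "\<not> always_embeds n 4"
    using not_always_embeds_diagonal[of n 4] not_always_embeds_odd by auto
  then show "psi_plus n = 3"
    using psi_plus_eqI[of n 3] always_embeds_small[of 3 n] n by auto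
next
  assume n: "even n \<and> n > 4"
  then have "n > 5" by (cases "n = 5") auto
  then show "psi_plus n = 5"
    using psi_plus_eqI[of n 5] always_embeds_5 not_always_embeds_6 n by auto
qed

end
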